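(* Let $L$ be a nonabelian nilpotent Lie algebra with $\dim L = n$, $\dim L^2 = m$ and $\dim Z(L) = d$. Then for all $n \ge 3$, $d \ge 1$ and $m \le \left\lfloor \frac{n-2}{d+1} \right\rfloor$, the upper bound $\dim M(L) \le \frac{1}{2}(n+m-2)(n-m-1)+1$ is better than the upper bound $\dim M(L) \le \dim M(L/L^2) + \dim L^2\,(\dim L/Z(L) - 1)$; that is, $$\frac{1}{2}(n+m-2)(n-m-1)+1 \;\le\; \dim M(L/L^2) + \dim L^2 \cdot \left(\dim L/Z(L) - 1\right).$$
   Context: All Lie algebras are finite dimensional over a fixed field, and dimensions are taken over that field. $L^2=[L,L]$ is the derived subalgebra and $Z(L)$ is the center of $L$. $M(L)$ denotes the Schur multiplier of $L$, i.e. the second homology $H_2(L)$ of $L$ with trivial coefficients; equivalently $M(L)\cong (R\cap [F,F])/[R,F]$ for any presentation $L\cong F/R$ with $F$ a free Lie algebra. Both displayed upper bounds for $\dim M(L)$ are previously known inequalities valid for finite dimensional nonabelian nilpotent Lie algebras. An upper bound is called better than another when its right-hand side is less than or equal to the right-hand side of the other. *)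

theory Defs
  imports Complex_Main "HOL-Algebra.QuotRing" "Jordan_Normal_Form.Missing_VectorSpace"
begin

section \<open>Lie algebras\<close>

text \<open>Vector spaces are the \<^locale>\<open>vectorspace\<close>s over HOL-Algebra fields; the fields
  \<open>mult\<close> and \<open>one\<close> that module records inherit from rings play no role.\<close>

record ('k, 'a) lie_alg = "('k, 'a) module" +
  bracket :: "'a \<Rightarrow> 'a \<Rightarrow> 'a"

locale lie_algebra = vectorspace K L
  for K :: "('k, 'r) ring_scheme" (structure) and L :: "('k, 'a, 'c) lie_alg_scheme" (structure) +
  assumes bracket_closed:
      "\<lbrakk>x \<in> carrier L; y \<in> carrier L\<rbrakk> \<Longrightarrow> bracket L x y \<in> carrier L"
    and bracket_add_left:
      "\<lbrakk>x \<in> carrier L; y \<in> carrier L; z \<in> carrier L\<rbrakk> \<Longrightarrow>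
        bracket L (x \<oplus>\<^bsub>L\<^esub> y) z = bracket L x z \<oplus>\<^bsub>L\<^esub> bracket L y z"
    and bracket_add_right:
      "\<lbrakk>x \<in> carrier L; y \<in> carrier L; z \<in> carrier L\<rbrakk> \<Longrightarrow>
        bracket L x (y \<oplus>\<^bsub>L\<^esub> z) = bracket L x y \<oplus>\<^bsub>L\<^esub> bracket L x z"
    and bracket_smult_left:
      "\<lbrakk>a \<in> carrier K; x \<in> carrier L; y \<in> carrier L\<rbrakk> \<Longrightarrow>
        bracket L (a \<odot>\<^bsub>L\<^esub> x) y = a \<odot>\<^bsub>L\<^esub> bracket L x y"
    and bracket_smult_right:
      "\<lbrakk>a \<in> carrier K; x \<in> carrier L; y \<in> carrier L\<rbrakk> \<Longrightarrow>
        bracket L x (a \<odot>\<^bsub>L\<^esub> y) = a \<odot>\<^bsub>L\<^esub> bracket L x y"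
    and bracket_self:
      "x \<in> carrier L \<Longrightarrow> bracket L x x = \<zero>\<^bsub>L\<^esub>"
    and jacobi:
      "\<lbrakk>x \<in> carrier L; y \<in> carrier L; z \<in> carrier L\<rbrakk> \<Longrightarrow>
        bracket L x (bracket L y z) \<oplus>\<^bsub>L\<^esub> bracket L y (bracket L z x)
          \<oplus>\<^bsub>L\<^esub> bracket L z (bracket L x y) = \<zero>\<^bsub>L\<^esub>"

definition lie_abelian :: "('k, 'a, 'c) lie_alg_scheme \<Rightarrow> bool" where
  "lie_abelian L \<longleftrightarrow> (\<forall>x\<in>carrier L. \<forall>y\<in>carrier L. bracket L x y = \<zero>\<^bsub>L\<^esub>)"

definition lie_center :: "('k, 'a, 'c) lie_alg_scheme \<Rightarrow> 'a set" where
  "lie_center L = {z \<in> carrier L. \<forall>x\<in>carrier L. bracket L z x = \<zero>\<^bsub>L\<^esub>}"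

definition bracket_span ::
    "('k, 'r) ring_scheme \<Rightarrow> ('k, 'a, 'c) lie_alg_scheme \<Rightarrow> 'a set \<Rightarrow> 'a set \<Rightarrow> 'a set" where
  "bracket_span K L A B = module.span K L {bracket L x y | x y. x \<in> A \<and> y \<in> B}"

definition derived_subalgebra ::
    "('k, 'r) ring_scheme \<Rightarrow> ('k, 'a, 'c) lie_alg_scheme \<Rightarrow> 'a set" where
  "derived_subalgebra K L = bracket_span K L (carrier L) (carrier L)"

primrec lower_central ::
    "('k, 'r) ring_scheme \<Rightarrow> ('k, 'a, 'c) lie_alg_scheme \<Rightarrow> nat \<Rightarrow> 'a set" where
  "lower_central K L 0 = carrier L"
| "lower_central K L (Suc i) = bracket_span K L (carrier L) (lower_central K L i)"

definition lie_nilpotent :: "('k, 'r) ring_scheme \<Rightarrow> ('k, 'a, 'c) lie_alg_scheme \<Rightarrow> bool" where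
  "lie_nilpotent K L \<longleftrightarrow> (\<exists>c. lower_central K L c = {\<zero>\<^bsub>L\<^esub>})"


section \<open>Quotients\<close>

text \<open>Elements of a quotient are cosets. An operation on cosets is the union of the cosets
  of its values on representatives, as in \<^const>\<open>rcoset_mult\<close>; when the operation
  respects the cosets, all members of this union coincide.\<close>

definition quot_space :: "('k, 'a, 'c) module_scheme \<Rightarrow> 'a set \<Rightarrow> ('k, 'a set) module" where
  "quot_space V W =
    \<lparr>carrier = a_rcosets\<^bsub>V\<^esub> W,
     mult = (\<lambda>X Y. W), one = W,
     zero = W, add = set_add V,
     smult = (\<lambda>a X. \<Union>x\<in>X. W +>\<^bsub>V\<^esub> (a \<odot>\<^bsub>V\<^esub> x))\<rparr>"

definition quot_lie :: "('k, 'a, 'c) lie_alg_scheme \<Rightarrow> 'a set \<Rightarrow> ('k, 'a set) lie_alg" where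
  "quot_lie L I =
    \<lparr>carrier = carrier (quot_space L I),
     mult = mult (quot_space L I), one = one (quot_space L I),
     zero = zero (quot_space L I), add = add (quot_space L I),
     smult = smult (quot_space L I),
     bracket = (\<lambda>X Y. \<Union>x\<in>X. \<Union>y\<in>Y. I +>\<^bsub>L\<^esub> bracket L x y)\<rparr>"


section \<open>Exterior powers\<close>

text \<open>The vector space with basis \<open>X\<close>, as finitely supported functions.\<close>

definition free_space :: "('k, 'r) ring_scheme \<Rightarrow> 'x set \<Rightarrow> ('k, 'x \<Rightarrow> 'k) module" where
  "free_space K X =
    \<lparr>carrier = {f. (\<forall>x. f x \<in> carrier K) \<and> finite {x. f x \<noteq> \<zero>\<^bsub>K\<^esub>} \<and> {x. f x \<noteq> \<zero>\<^bsub>K\<^esub>} \<subseteq> X},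
     mult = (\<lambda>f g x. \<zero>\<^bsub>K\<^esub>), one = (\<lambda>x. \<zero>\<^bsub>K\<^esub>),
     zero = (\<lambda>x. \<zero>\<^bsub>K\<^esub>), add = (\<lambda>f g x. f x \<oplus>\<^bsub>K\<^esub> g x),
     smult = (\<lambda>a f x. a \<otimes>\<^bsub>K\<^esub> f x)\<rparr>"

definition free_gen :: "('k, 'r) ring_scheme \<Rightarrow> 'x \<Rightarrow> 'x \<Rightarrow> 'k" where
  "free_gen K x = (\<lambda>y. if y = x then \<one>\<^bsub>K\<^esub> else \<zero>\<^bsub>K\<^esub>)"

definition lin_ext ::
    "('k, 'r) ring_scheme \<Rightarrow> ('k, 'a, 'c) module_scheme \<Rightarrow> ('x \<Rightarrow> 'a) \<Rightarrow> ('x \<Rightarrow> 'k) \<Rightarrow> 'a" where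
  "lin_ext K V \<phi> f = (\<Oplus>\<^bsub>V\<^esub>x\<in>{x. f x \<noteq> \<zero>\<^bsub>K\<^esub>}. f x \<odot>\<^bsub>V\<^esub> \<phi> x)"

text \<open>The \<open>p\<close>-th exterior power is the free space on \<open>p\<close>-tuples (lists of length \<open>p\<close>) of
  vectors modulo multilinearity and the vanishing of tuples with a repeated entry.\<close>

definition tuples :: "nat \<Rightarrow> ('k, 'a, 'c) module_scheme \<Rightarrow> 'a list set" where
  "tuples p V = {xs. set xs \<subseteq> carrier V \<and> length xs = p}"

definition ext_relations ::
    "('k, 'r) ring_scheme \<Rightarrow> nat \<Rightarrow> ('k, 'a, 'c) module_scheme \<Rightarrow> ('a list \<Rightarrow> 'k) set" where
  "ext_relations K p V =
    (let F = free_space K (tuples p V) in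
      {free_gen K (us @ [x \<oplus>\<^bsub>V\<^esub> y] @ vs)
          \<ominus>\<^bsub>F\<^esub> free_gen K (us @ [x] @ vs) \<ominus>\<^bsub>F\<^esub> free_gen K (us @ [y] @ vs) | us vs x y.
        us @ [x] @ vs \<in> tuples p V \<and> y \<in> carrier V}
    \<union> {free_gen K (us @ [a \<odot>\<^bsub>V\<^esub> x] @ vs) \<ominus>\<^bsub>F\<^esub> (a \<odot>\<^bsub>F\<^esub> free_gen K (us @ [x] @ vs)) | us vs a x.
        us @ [x] @ vs \<in> tuples p V \<and> a \<in> carrier K}
    \<union> {free_gen K xs | xs. xs \<in> tuples p V \<and> \<not> distinct xs})"

definition ext_null ::
    "('k, 'r) ring_scheme \<Rightarrow> nat \<Rightarrow> ('k, 'a, 'c) module_scheme \<Rightarrow> ('a list \<Rightarrow> 'k) set" where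
  "ext_null K p V = module.span K (free_space K (tuples p V)) (ext_relations K p V)"

definition ext_power ::
    "('k, 'r) ring_scheme \<Rightarrow> nat \<Rightarrow> ('k, 'a, 'c) module_scheme
      \<Rightarrow> ('k, ('a list \<Rightarrow> 'k) set) module" where
  "ext_power K p V = quot_space (free_space K (tuples p V)) (ext_null K p V)"

definition wedge ::
    "('k, 'r) ring_scheme \<Rightarrow> ('k, 'a, 'c) module_scheme \<Rightarrow> 'a list \<Rightarrow> ('a list \<Rightarrow> 'k) set" where
  "wedge K V xs =
    ext_null K (length xs) V +>\<^bsub>free_space K (tuples (length xs) V)\<^esub> free_gen K xs"


section \<open>The Schur multiplier\<close>

text \<open>The multiplier is the second homology of the Chevalley--Eilenberg complex with trivial
  coefficients, whose differentials in degrees 2 and 3 are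
  \<open>x \<and> y \<mapsto> [x,y]\<close> and \<open>x \<and> y \<and> z \<mapsto> [x,y] \<and> z - [x,z] \<and> y + [y,z] \<and> x\<close>.
  Each is evaluated on a coset through representatives; the bracket being bilinear and
  alternating, the image over all representatives is a singleton.\<close>

definition ce_d2 ::
    "('k, 'r) ring_scheme \<Rightarrow> ('k, 'a, 'c) lie_alg_scheme \<Rightarrow> ('a list \<Rightarrow> 'k) set \<Rightarrow> 'a" where
  "ce_d2 K L w = the_elem (lin_ext K L (\<lambda>xs. bracket L (xs ! 0) (xs ! 1)) ` w)"

definition ce_d3 ::
    "('k, 'r) ring_scheme \<Rightarrow> ('k, 'a, 'c) lie_alg_scheme
      \<Rightarrow> ('a list \<Rightarrow> 'k) set \<Rightarrow> ('a list \<Rightarrow> 'k) set" where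
  "ce_d3 K L w =
    (let E = ext_power K 2 L in
      the_elem (lin_ext K E (\<lambda>xs.
        wedge K L [bracket L (xs ! 0) (xs ! 1), xs ! 2]
          \<ominus>\<^bsub>E\<^esub> wedge K L [bracket L (xs ! 0) (xs ! 2), xs ! 1]
          \<oplus>\<^bsub>E\<^esub> wedge K L [bracket L (xs ! 1) (xs ! 2), xs ! 0]) ` w))"

definition schur_multiplier ::
    "('k, 'r) ring_scheme \<Rightarrow> ('k, 'a, 'c) lie_alg_scheme
      \<Rightarrow> ('k, ('a list \<Rightarrow> 'k) set set) module" where
  "schur_multiplier K L =
    (let E = ext_power K 2 L in
      quot_space (E\<lparr>carrier := {w \<in> carrier E. ce_d2 K L w = \<zero>\<^bsub>L\<^esub>}\<rparr>)
        (ce_d3 K L ` carrier (ext_power K 3 L)))"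

end

theory Submission
  imports Defs
begin

text \<open>Let \<open>q = n - m\<close> be the dimension of the abelianization \<open>L/L\<^sup>2\<close>. The inequality is a comparison of
numbers once the dimensions on its right-hand side are known.

Rank and nullity of the projections give \<open>dim (L/L\<^sup>2) = n - m\<close> and \<open>dim (L/Z(L)) = n - d\<close>
(\<open>quotient_dim\<close>). The algebra \<open>L/L\<^sup>2\<close> is abelian, so the differentials of its Chevalley--Eilenberg
complex vanish and its multiplier is the whole exterior square, of dimension \<open>q (q - 1) / 2\<close>
(\<open>dim_schur_multiplier_abelian\<close>). With these values the right-hand side minus the left-hand side
is
  \<open>(n - 2 - m (d + 1)) + m m\<close>,
and the first summand is nonnegative by the hypothesis on \<open>m\<close>.

The substance is therefore the dimension of the exterior square of a space of dimension \<open>q\<close>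
(\<open>dim_ext_square\<close>), starting from its definition as a quotient of the free space on all pairs of
vectors. The wedges of pairs of basis vectors generate it by bilinearity and antisymmetry. They
are independent because the two by two minors of the coordinates are bilinear and alternating,
hence define a linear map on the quotient, which takes these wedges to unit vectors.\<close>

section \<open>Linear maps and coordinates\<close>

lemma linear_mapI:
  assumes "vectorspace K V" and "vectorspace K W"
    and "\<And>v. v \<in> carrier V \<Longrightarrow> T v \<in> carrier W"
    and "\<And>u v. u \<in> carrier V \<Longrightarrow> v \<in> carrier V \<Longrightarrow> T (u \<oplus>\<^bsub>V\<^esub> v) = T u \<oplus>\<^bsub>W\<^esub> T v"
    and "\<And>a v. a \<in> carrier K \<Longrightarrow> v \<in> carrier V \<Longrightarrow> T (a \<odot>\<^bsub>V\<^esub> v) = a \<odot>\<^bsub>W\<^esub> T v"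
  shows "linear_map K V W T"
  using assms
  by (auto simp: linear_map_def mod_hom_def mod_hom_axioms_def module_hom_def vectorspace_def)

lemma linear_map_preimage:
  assumes T: "linear_map K V W T" and S: "LinearCombinations.submodule K S W"
  shows "LinearCombinations.submodule K {v \<in> carrier V. T v \<in> S} V"
proof -
  interpret V: vectorspace K V using T by (simp add: linear_map_def)
  interpret T: linear_map K V W T by fact
  show ?thesis using S by (auto simp: submodule_def V.module_axioms)
qed

lemma linear_map_compose:
  assumes S: "linear_map K U V S" and T: "linear_map K V W T"
  shows "linear_map K U W (\<lambda>u. T (S u))"
proof -
  interpret S: linear_map K U V S by fact
  interpret T: linear_map K V W T by fact
  show ?thesis
    by (rule linear_mapI) (use S T in \<open>auto simp: linear_map_def\<close>)
qed

lemma linear_map_id: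
  assumes "vectorspace K V"
  shows "linear_map K V V (\<lambda>v. v)"
  by (rule linear_mapI) (use assms in auto)

lemma linear_maps_eq_on_span:
  assumes S: "linear_map K V W S" and T: "linear_map K V W T"
    and B: "B \<subseteq> carrier V" "\<And>b. b \<in> B \<Longrightarrow> S b = T b" and v: "v \<in> module.span K V B"
  shows "S v = T v"
proof -
  interpret V: vectorspace K V using S by (simp add: linear_map_def)
  interpret S: linear_map K V W S by fact
  interpret T: linear_map K V W T by fact
  have "LinearCombinations.submodule K {v \<in> carrier V. S v = T v} V"
    by (auto simp: submodule_def V.module_axioms)
  then have "module.span K V B \<subseteq> {v \<in> carrier V. S v = T v}"
    by (rule V.span_is_subset[rotated]) (use B in auto)
  then show ?thesis using v by auto
qed

text \<open>The coefficient functions of a basis are linear, because the expansion of a vector in a basis is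
unique. They are given as functions into the field, so that products of them can be formed.\<close>

lemma (in vectorspace) coordinates:
  assumes B: "finite B" "basis B"
  obtains c where "\<And>v b. v \<in> carrier V \<Longrightarrow> b \<in> B \<Longrightarrow> c v b \<in> carrier K"
    and "\<And>u v b. u \<in> carrier V \<Longrightarrow> v \<in> carrier V \<Longrightarrow> b \<in> B \<Longrightarrow> c (u \<oplus>\<^bsub>V\<^esub> v) b = c u b \<oplus>\<^bsub>K\<^esub> c v b"
    and "\<And>a v b. a \<in> carrier K \<Longrightarrow> v \<in> carrier V \<Longrightarrow> b \<in> B \<Longrightarrow> c (a \<odot>\<^bsub>V\<^esub> v) b = a \<otimes>\<^bsub>K\<^esub> c v b"
    and "\<And>b b'. b \<in> B \<Longrightarrow> b' \<in> B \<Longrightarrow> c b b' = (if b' = b then \<one>\<^bsub>K\<^esub> else \<zero>\<^bsub>K\<^esub>)"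
proof -
  have BV: "B \<subseteq> carrier V" using B(2) by (simp add: basis_def)
  define c where "c v = (THE a. a \<in> B \<rightarrow>\<^sub>E carrier K \<and> lincomb a B = v)" for v
  have ex1: "\<exists>!a. a \<in> B \<rightarrow>\<^sub>E carrier K \<and> lincomb a B = v" if "v \<in> carrier V" for v
    using basis_criterion[OF B(1) BV] B(2) that by simp
  have c: "c v \<in> B \<rightarrow>\<^sub>E carrier K" "lincomb (c v) B = v" if "v \<in> carrier V" for v
    using theI'[OF ex1[OF that]] by (simp_all add: c_def)
  have uniq: "c v b = a b" if a: "a \<in> B \<rightarrow> carrier K" "lincomb a B = v" "b \<in> B" for a v b
  proof -
    have v: "v \<in> carrier V" using a BV by auto
    have "lincomb (restrict a B) B = lincomb a B"
      by (rule lincomb_cong) (use BV a in auto)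
    then have "restrict a B \<in> B \<rightarrow>\<^sub>E carrier K \<and> lincomb (restrict a B) B = v"
      using a by auto
    then have "c v = restrict a B" using ex1[OF v] c[OF v] by blast
    then show ?thesis using a(3) by simp
  qed
  have cK: "c v \<in> B \<rightarrow> carrier K" if "v \<in> carrier V" for v using c(1)[OF that] by auto
  show ?thesis
  proof (rule that[of c])
    show "c v b \<in> carrier K" if "v \<in> carrier V" "b \<in> B" for v b
      using cK[OF that(1)] that(2) by auto
  next
    fix u v b assume uv: "u \<in> carrier V" "v \<in> carrier V" and b: "b \<in> B"
    show "c (u \<oplus>\<^bsub>V\<^esub> v) b = c u b \<oplus>\<^bsub>K\<^esub> c v b"
    proof (rule uniq[OF _ _ b])
      show "lincomb (\<lambda>b. c u b \<oplus>\<^bsub>K\<^esub> c v b) B = u \<oplus>\<^bsub>V\<^esub> v"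
        using lincomb_sum[OF B(1) BV cK[OF uv(1)] cK[OF uv(2)]] c(2)[OF uv(1)] c(2)[OF uv(2)] by simp
    qed (use cK[OF uv(1)] cK[OF uv(2)] in auto)
  next
    fix a v b assume a: "a \<in> carrier K" and v: "v \<in> carrier V" and b: "b \<in> B"
    show "c (a \<odot>\<^bsub>V\<^esub> v) b = a \<otimes>\<^bsub>K\<^esub> c v b"
    proof (rule uniq[OF _ _ b])
      show "lincomb (\<lambda>b. a \<otimes>\<^bsub>K\<^esub> c v b) B = a \<odot>\<^bsub>V\<^esub> v"
        using lincomb_smult[OF BV cK[OF v] a] c(2)[OF v] by simp
    qed (use cK[OF v] a in auto)
  next
    fix b b' assume b: "b \<in> B" and b': "b' \<in> B"
    let ?a = "\<lambda>x. if x = b then \<one>\<^bsub>K\<^esub> else \<zero>\<^bsub>K\<^esub>"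
    have a: "?a \<in> B \<rightarrow> carrier K" by simp
    have rest: "lincomb ?a (B - {b}) = \<zero>\<^bsub>V\<^esub>" by (rule lincomb_zero) (use BV in auto)
    have "lincomb ?a B = b"
      using lincomb_del2[OF B(1) BV a b] b BV by (simp add: rest subset_iff)
    then show "c b b' = ?a b'" by (rule uniq[OF a _ b'])
  qed
qed

section \<open>Quotient spaces\<close>

lemma subspace_abelian_subgroup:
  assumes "subspace K W V"
  shows "abelian_subgroup W V"
proof -
  interpret V: vectorspace K V using assms by (simp add: subspace_def)
  have sub: "LinearCombinations.submodule K W V" using assms by (simp add: subspace_def)
  have WV: "W \<subseteq> carrier V" by (rule submodule.subset[OF sub])
  show ?thesis
  proof (rule abelian_subgroupI3)
    show "abelian_group V" by (rule V.abelian_group_axioms)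
    show "additive_subgroup W V"
      unfolding additive_subgroup_def
    proof (rule group.subgroupI)
      show "Group.group (add_monoid V)" by (rule V.a_group)
      show "W \<subseteq> carrier (add_monoid V)" using WV by simp
      show "W \<noteq> {}" using submodule.zero_closed[OF sub] by auto
      fix v w assume v: "v \<in> W" and w: "w \<in> W"
      show "v \<otimes>\<^bsub>add_monoid V\<^esub> w \<in> W" using submodule.m_closed[OF sub v w] by simp
      have "\<ominus>\<^bsub>V\<^esub> v = (\<ominus>\<^bsub>K\<^esub> \<one>\<^bsub>K\<^esub>) \<odot>\<^bsub>V\<^esub> v" using v WV V.smult_minus_1 by auto
      also have "\<dots> \<in> W" using submodule.smult_closed[OF sub _ v] by simp
      finally show "inv\<^bsub>add_monoid V\<^esub> v \<in> W" by (simp add: a_inv_def)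
    qed
  qed
qed

text \<open>Quotients occur both as plain vector spaces and as Lie algebras, that is, as records of different
types. Subspaces, linear maps and dimensions depend only on the four components below, so stating
the facts for any record with these components covers both at once.\<close>

definition is_quotient where
  "is_quotient V W Q \<longleftrightarrow>
    carrier Q = a_rcosets\<^bsub>V\<^esub> W \<and> add Q = set_add V \<and> zero Q = W \<and>
    smult Q = (\<lambda>a X. \<Union>x\<in>X. W +>\<^bsub>V\<^esub> (a \<odot>\<^bsub>V\<^esub> x))"

context
  fixes K :: "('k, 'r) ring_scheme" and V :: "('k, 'a, 'c) module_scheme"
    and W :: "'a set" and Q :: "('k, 'a set, 'd) module_scheme"
  assumes sub: "subspace K W V" and Q: "is_quotient V W Q"
begin

interpretation V: vectorspace K V using sub by (simp add: subspace_def)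
interpretation W: abelian_subgroup W V by (rule subspace_abelian_subgroup[OF sub])

lemma coset_eq_zero_iff:
  assumes "v \<in> carrier V"
  shows "W +>\<^bsub>V\<^esub> v = W \<longleftrightarrow> v \<in> W"
  using W.a_rcos_self[OF assms] W.a_rcos_const by auto

lemma quotient_carrier: "carrier Q = (\<lambda>v. W +>\<^bsub>V\<^esub> v) ` carrier V"
  using Q by (auto simp: is_quotient_def A_RCOSETS_def')

lemma quotient_zero: "\<zero>\<^bsub>Q\<^esub> = W"
  using Q by (simp add: is_quotient_def)

lemma quotient_add:
  assumes "u \<in> carrier V" "v \<in> carrier V"
  shows "(W +>\<^bsub>V\<^esub> u) \<oplus>\<^bsub>Q\<^esub> (W +>\<^bsub>V\<^esub> v) = W +>\<^bsub>V\<^esub> (u \<oplus>\<^bsub>V\<^esub> v)"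
  using Q W.a_rcos_sum[OF assms] by (simp add: is_quotient_def)

lemma coset_subset: "v \<in> carrier V \<Longrightarrow> W +>\<^bsub>V\<^esub> v \<subseteq> carrier V"
  using W.a_subset V.a_r_coset_subset_G by auto

lemma quotient_smult:
  assumes a: "a \<in> carrier K" and v: "v \<in> carrier V"
  shows "a \<odot>\<^bsub>Q\<^esub> (W +>\<^bsub>V\<^esub> v) = W +>\<^bsub>V\<^esub> (a \<odot>\<^bsub>V\<^esub> v)"
proof -
  have WV: "W \<subseteq> carrier V" using W.a_subset .
  have "W +>\<^bsub>V\<^esub> (a \<odot>\<^bsub>V\<^esub> x) = W +>\<^bsub>V\<^esub> (a \<odot>\<^bsub>V\<^esub> v)" if x: "x \<in> W +>\<^bsub>V\<^esub> v" for x
  proof -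
    from x obtain w where w: "w \<in> W" "x = w \<oplus>\<^bsub>V\<^esub> v"
      by (auto simp: a_r_coset_def')
    have wV: "w \<in> carrier V" using w WV by auto
    have aw: "a \<odot>\<^bsub>V\<^esub> w \<in> W"
      using sub a w(1) by (auto simp: subspace_def intro: submodule.smult_closed)
    have "a \<odot>\<^bsub>V\<^esub> x = (a \<odot>\<^bsub>V\<^esub> w) \<oplus>\<^bsub>V\<^esub> (a \<odot>\<^bsub>V\<^esub> v)"
      using w a v wV by (simp add: V.smult_r_distr)
    then have "a \<odot>\<^bsub>V\<^esub> x \<in> W +>\<^bsub>V\<^esub> (a \<odot>\<^bsub>V\<^esub> v)"
      using aw by (auto simp: a_r_coset_def')
    then show ?thesis using W.a_repr_independence' a v by auto
  qed
  moreover have "W +>\<^bsub>V\<^esub> v \<noteq> {}" using W.a_rcos_self[OF v] by auto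
  ultimately have "(\<Union>x\<in>W +>\<^bsub>V\<^esub> v. W +>\<^bsub>V\<^esub> (a \<odot>\<^bsub>V\<^esub> x)) = W +>\<^bsub>V\<^esub> (a \<odot>\<^bsub>V\<^esub> v)"
    by auto
  then show ?thesis using Q by (simp add: is_quotient_def)
qed

lemma quotient_vectorspace: "vectorspace K Q"
proof -
  have z: "\<zero>\<^bsub>Q\<^esub> = W +>\<^bsub>V\<^esub> \<zero>\<^bsub>V\<^esub>"
    using coset_eq_zero_iff[of "\<zero>\<^bsub>V\<^esub>"] W.zero_closed quotient_zero by simp
  show ?thesis
  proof (rule vs_criteria, goal_cases)
    case 4
    show ?case
    proof
      fix X assume "X \<in> carrier Q"
      then obtain v where v: "v \<in> carrier V" "X = W +>\<^bsub>V\<^esub> v" by (auto simp: quotient_carrier)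
      have "X \<oplus>\<^bsub>Q\<^esub> (W +>\<^bsub>V\<^esub> (\<ominus>\<^bsub>V\<^esub> v)) = \<zero>\<^bsub>Q\<^esub>"
        using v by (simp add: quotient_add z V.r_neg)
      then show "\<exists>Y\<in>carrier Q. X \<oplus>\<^bsub>Q\<^esub> Y = \<zero>\<^bsub>Q\<^esub>" using v by (auto simp: quotient_carrier)
    qed
  qed (auto simp: quotient_carrier z quotient_add quotient_smult V.a_ac V.smult_assoc1
        V.smult_l_distr V.smult_r_distr intro: V.field_axioms)
qed

lemma quotient_linear_map: "linear_map K V Q (\<lambda>v. W +>\<^bsub>V\<^esub> v)"
  using V.vectorspace_axioms quotient_vectorspace
  by (rule linear_mapI) (auto simp: quotient_carrier quotient_add quotient_smult)

lemma quotient_dim: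
  assumes "vectorspace.fin_dim K V"
  shows "vectorspace.fin_dim K Q"
    and "vectorspace.dim K Q + vectorspace.dim K (V\<lparr>carrier := W\<rparr>) = vectorspace.dim K V"
proof -
  interpret T: linear_map K V Q "\<lambda>v. W +>\<^bsub>V\<^esub> v" by (rule quotient_linear_map)
  have ker: "T.kerT = W"
    using coset_eq_zero_iff W.a_subset by (auto simp: T.ker_def quotient_zero)
  have im: "T.imT = carrier Q" by (simp add: T.im_def quotient_carrier)
  show "vectorspace.fin_dim K Q"
    using T.rank_nullity_main(2)[OF assms] by (simp add: quotient_carrier)
  show "vectorspace.dim K Q + vectorspace.dim K (V\<lparr>carrier := W\<rparr>) = vectorspace.dim K V"
    using T.rank_nullity[OF assms] by (simp add: ker im)
qed

end

lemma is_quotient_quot_space: "is_quotient V W (quot_space V W)"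
  by (simp add: is_quotient_def quot_space_def)

lemma is_quotient_quot_lie: "is_quotient L I (quot_lie L I)"
  by (simp add: is_quotient_def quot_lie_def quot_space_def)

lemma dim_quot_space_zero:
  assumes "vectorspace K V" "vectorspace.fin_dim K V"
  shows "vectorspace.dim K (quot_space V {\<zero>\<^bsub>V\<^esub>}) = vectorspace.dim K V"
proof -
  interpret V: vectorspace K V by fact
  have sub: "subspace K {\<zero>\<^bsub>V\<^esub>} V"
    using assms(1) by (auto simp: subspace_def submodule_def V.module_axioms)
  interpret Z: vectorspace K "V\<lparr>carrier := {\<zero>\<^bsub>V\<^esub>}\<rparr>" by (rule V.subspace_is_vs[OF sub])
  have "Z.dim = 0"
    using Z.gen_ge_dim[of "{}"] by (simp add: Z.span_empty)
  then show ?thesis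
    using quotient_dim(2)[OF sub is_quotient_quot_space assms(2)] by simp
qed

section \<open>Free spaces\<close>

lemma free_space_vectorspace:
  fixes K :: "('k, 'r) ring_scheme" and X :: "'x set"
  assumes "field K"
  shows "vectorspace K (free_space K X)"
proof -
  interpret K: field K by (rule assms)
  have fin_add: "finite {x. f x \<oplus>\<^bsub>K\<^esub> g x \<noteq> \<zero>\<^bsub>K\<^esub>}"
    if "finite {x. f x \<noteq> \<zero>\<^bsub>K\<^esub>}" "finite {x. g x \<noteq> \<zero>\<^bsub>K\<^esub>}" for f g :: "'x \<Rightarrow> 'k"
    by (rule finite_subset[OF _ finite_UnI[OF that]]) auto
  have fin_mult: "finite {x. a \<otimes>\<^bsub>K\<^esub> f x \<noteq> \<zero>\<^bsub>K\<^esub>}"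
    if "finite {x. f x \<noteq> \<zero>\<^bsub>K\<^esub>}" "a \<in> carrier K" for a and f :: "'x \<Rightarrow> 'k"
    by (rule finite_subset[OF _ that(1)]) (use that(2) in auto)
  have fin_neg: "finite {x. \<ominus>\<^bsub>K\<^esub> f x \<noteq> \<zero>\<^bsub>K\<^esub>}"
    if "finite {x. f x \<noteq> \<zero>\<^bsub>K\<^esub>}" for f :: "'x \<Rightarrow> 'k"
    by (rule finite_subset[OF _ that(1)]) auto
  have in_F: "f \<in> carrier (free_space K X) \<longleftrightarrow>
      (\<forall>x. f x \<in> carrier K) \<and> finite {x. f x \<noteq> \<zero>\<^bsub>K\<^esub>} \<and> (\<forall>x. x \<notin> X \<longrightarrow> f x = \<zero>\<^bsub>K\<^esub>)" for f
    by (auto simp: free_space_def)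
  have ops: "\<zero>\<^bsub>free_space K X\<^esub> = (\<lambda>x. \<zero>\<^bsub>K\<^esub>)"
    "f \<oplus>\<^bsub>free_space K X\<^esub> g = (\<lambda>x. f x \<oplus>\<^bsub>K\<^esub> g x)"
    "a \<odot>\<^bsub>free_space K X\<^esub> f = (\<lambda>x. a \<otimes>\<^bsub>K\<^esub> f x)" for f g a
    by (simp_all add: free_space_def)
  show ?thesis
  proof (rule vs_criteria, goal_cases)
    case 4
    show ?case
    proof
      fix f assume f: "f \<in> carrier (free_space K X)"
      show "\<exists>g\<in>carrier (free_space K X). f \<oplus>\<^bsub>free_space K X\<^esub> g = \<zero>\<^bsub>free_space K X\<^esub>"
        by (rule bexI[of _ "\<lambda>x. \<ominus>\<^bsub>K\<^esub> f x"]) (use f in \<open>auto simp: in_F ops K.r_neg fin_neg\<close>)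
    qed
  qed (auto simp: in_F ops fin_add fin_mult K.a_ac K.m_assoc K.l_distr K.r_distr intro: assms)
qed

lemma free_gen_closed:
  assumes "field K" "x \<in> X"
  shows "free_gen K x \<in> carrier (free_space K X)"
proof -
  interpret K: field K by (rule assms)
  show ?thesis using assms(2) by (auto simp: free_space_def free_gen_def)
qed

text \<open>The linear extension is a sum over the support of its argument, which changes under addition.
Summing over a larger finite set with zero summands makes the sums for different arguments
comparable.\<close>

lemma lin_ext_superset:
  assumes "vectorspace K V" and "\<phi> \<in> S \<rightarrow> carrier V"
    and "\<And>x. f x \<in> carrier K" and "finite S" and "{x. f x \<noteq> \<zero>\<^bsub>K\<^esub>} \<subseteq> S"
  shows "lin_ext K V \<phi> f = (\<Oplus>\<^bsub>V\<^esub>x\<in>S. f x \<odot>\<^bsub>V\<^esub> \<phi> x)"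
proof -
  interpret V: vectorspace K V by fact
  have "\<zero>\<^bsub>K\<^esub> \<odot>\<^bsub>V\<^esub> \<phi> x = \<zero>\<^bsub>V\<^esub>" if "x \<in> S" for x using assms(2) that by (auto intro: V.lmult_0)
  then show ?thesis unfolding lin_ext_def
    by (intro V.add.finprod_mono_neutral_cong_left) (use assms in auto)
qed

lemma lin_ext_linear_map:
  assumes "vectorspace K V" and \<phi>: "\<phi> \<in> X \<rightarrow> carrier V"
  shows "linear_map K (free_space K X) V (lin_ext K V \<phi>)"
proof -
  interpret V: vectorspace K V by fact
  interpret F: vectorspace K "free_space K X" by (rule free_space_vectorspace) unfold_locales
  have FD: "f x \<in> carrier K" "finite {x. f x \<noteq> \<zero>\<^bsub>K\<^esub>}" "{x. f x \<noteq> \<zero>\<^bsub>K\<^esub>} \<subseteq> X"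
    if "f \<in> carrier (free_space K X)" for f x
    using that by (auto simp: free_space_def)
  note ext = lin_ext_superset[OF assms(1)]
  show ?thesis
  proof (rule linear_mapI)
    fix f assume f: "f \<in> carrier (free_space K X)"
    have "f x \<odot>\<^bsub>V\<^esub> \<phi> x \<in> carrier V" if "f x \<noteq> \<zero>\<^bsub>K\<^esub>" for x
      using FD[OF f] that \<phi> by (intro V.smult_closed) auto
    then show "lin_ext K V \<phi> f \<in> carrier V"
      unfolding lin_ext_def by (intro V.M.finsum_closed) auto
  next
    fix f g assume f: "f \<in> carrier (free_space K X)" and g: "g \<in> carrier (free_space K X)"
    let ?S = "{x. f x \<noteq> \<zero>\<^bsub>K\<^esub>} \<union> {x. g x \<noteq> \<zero>\<^bsub>K\<^esub>}"
    have S: "finite ?S" "?S \<subseteq> X" using FD[OF f] FD[OF g] by auto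
    then have \<phi>S: "\<phi> \<in> ?S \<rightarrow> carrier V" using \<phi> by auto
    have "lin_ext K V \<phi> (f \<oplus>\<^bsub>free_space K X\<^esub> g)
        = (\<Oplus>\<^bsub>V\<^esub>x\<in>?S. (f x \<oplus>\<^bsub>K\<^esub> g x) \<odot>\<^bsub>V\<^esub> \<phi> x)"
    proof -
      have "f x \<oplus>\<^bsub>K\<^esub> g x = \<zero>\<^bsub>K\<^esub>" if "x \<notin> ?S" for x using that by simp
      then have "{x. f x \<oplus>\<^bsub>K\<^esub> g x \<noteq> \<zero>\<^bsub>K\<^esub>} \<subseteq> ?S" by blast
      then show ?thesis
        using ext[OF \<phi>S _ S(1), of "\<lambda>x. f x \<oplus>\<^bsub>K\<^esub> g x"] FD(1)[OF f] FD(1)[OF g]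
        by (simp add: free_space_def)
    qed
    also have "\<dots> = (\<Oplus>\<^bsub>V\<^esub>x\<in>?S. f x \<odot>\<^bsub>V\<^esub> \<phi> x \<oplus>\<^bsub>V\<^esub> g x \<odot>\<^bsub>V\<^esub> \<phi> x)"
      by (rule V.M.finsum_cong') (use \<phi>S FD(1)[OF f] FD(1)[OF g] in \<open>auto simp: V.smult_l_distr Pi_iff\<close>)
    also have "\<dots> = (\<Oplus>\<^bsub>V\<^esub>x\<in>?S. f x \<odot>\<^bsub>V\<^esub> \<phi> x) \<oplus>\<^bsub>V\<^esub> (\<Oplus>\<^bsub>V\<^esub>x\<in>?S. g x \<odot>\<^bsub>V\<^esub> \<phi> x)"
      by (rule V.M.finsum_addf) (use \<phi>S FD(1)[OF f] FD(1)[OF g] in \<open>auto simp: Pi_iff\<close>)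
    also have "\<dots> = lin_ext K V \<phi> f \<oplus>\<^bsub>V\<^esub> lin_ext K V \<phi> g"
      using ext[OF \<phi>S _ S(1), of f] ext[OF \<phi>S _ S(1), of g] FD(1)[OF f] FD(1)[OF g] by simp
    finally show "lin_ext K V \<phi> (f \<oplus>\<^bsub>free_space K X\<^esub> g)
        = lin_ext K V \<phi> f \<oplus>\<^bsub>V\<^esub> lin_ext K V \<phi> g" .
  next
    fix a f assume a: "a \<in> carrier K" and f: "f \<in> carrier (free_space K X)"
    let ?S = "{x. f x \<noteq> \<zero>\<^bsub>K\<^esub>}"
    have \<phi>S: "\<phi> \<in> ?S \<rightarrow> carrier V" using \<phi> FD(3)[OF f] by auto
    have "lin_ext K V \<phi> (a \<odot>\<^bsub>free_space K X\<^esub> f) = (\<Oplus>\<^bsub>V\<^esub>x\<in>?S. (a \<otimes>\<^bsub>K\<^esub> f x) \<odot>\<^bsub>V\<^esub> \<phi> x)"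
    proof -
      have "{x. a \<otimes>\<^bsub>K\<^esub> f x \<noteq> \<zero>\<^bsub>K\<^esub>} \<subseteq> ?S" using a by auto
      then show ?thesis
        using ext[OF \<phi>S _ FD(2)[OF f], of "\<lambda>x. a \<otimes>\<^bsub>K\<^esub> f x"] FD(1)[OF f] a
        by (simp add: free_space_def)
    qed
    also have "\<dots> = (\<Oplus>\<^bsub>V\<^esub>x\<in>?S. a \<odot>\<^bsub>V\<^esub> (f x \<odot>\<^bsub>V\<^esub> \<phi> x))"
      by (rule V.M.finsum_cong') (use \<phi>S FD(1)[OF f] a in \<open>auto simp: V.smult_assoc1 Pi_iff\<close>)
    also have "\<dots> = a \<odot>\<^bsub>V\<^esub> lin_ext K V \<phi> f"
      unfolding lin_ext_def
      by (rule V.finsum_smult[symmetric]) (use \<phi>S FD(1)[OF f] a in \<open>auto simp: Pi_iff\<close>)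
    finally show "lin_ext K V \<phi> (a \<odot>\<^bsub>free_space K X\<^esub> f) = a \<odot>\<^bsub>V\<^esub> lin_ext K V \<phi> f" .
  qed (use assms F.vectorspace_axioms in auto)
qed

lemma lin_ext_free_gen:
  assumes "vectorspace K V" and "\<phi> x \<in> carrier V"
  shows "lin_ext K V \<phi> (free_gen K x) = \<phi> x"
proof -
  interpret V: vectorspace K V by fact
  have "lin_ext K V \<phi> (free_gen K x) = (\<Oplus>\<^bsub>V\<^esub>y\<in>{x}. free_gen K x y \<odot>\<^bsub>V\<^esub> \<phi> y)"
    by (rule lin_ext_superset) (use assms in \<open>auto simp: free_gen_def\<close>)
  also have "\<dots> = \<phi> x"
    using assms(2) by (simp add: V.M.finsum_insert free_gen_def)
  finally show ?thesis .
qed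

lemma span_free_gen:
  assumes "field K"
  shows "module.span K (free_space K X) (free_gen K ` X) = carrier (free_space K X)" (is "?S = _")
proof -
  interpret K: field K by fact
  let ?F = "free_space K X"
  interpret F: vectorspace K ?F by (rule free_space_vectorspace) fact
  have gX: "free_gen K ` X \<subseteq> carrier ?F" using free_gen_closed[OF assms] by auto
  have sub: "LinearCombinations.submodule K ?S ?F" by (rule F.span_is_submodule[OF gX])
  have *: "f \<in> ?S" if "finite S" "S \<subseteq> X" "\<And>x. f x \<in> carrier K" "{x. f x \<noteq> \<zero>\<^bsub>K\<^esub>} \<subseteq> S" for S f
    using that
  proof (induction S arbitrary: f)
    case empty
    then have "f = \<zero>\<^bsub>?F\<^esub>" by (auto simp: free_space_def)
    then show ?case using submodule.zero_closed[OF sub] by simp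
  next
    case (insert s S)
    let ?g = "f(s := \<zero>\<^bsub>K\<^esub>)"
    have g: "?g \<in> ?S" by (rule insert.IH) (use insert.prems insert.hyps in auto)
    have "free_gen K s \<in> ?S" using F.in_own_span[OF gX] insert.prems by auto
    then have "f s \<odot>\<^bsub>?F\<^esub> free_gen K s \<in> ?S"
      using submodule.smult_closed[OF sub] insert.prems by blast
    then have "?g \<oplus>\<^bsub>?F\<^esub> (f s \<odot>\<^bsub>?F\<^esub> free_gen K s) \<in> ?S"
      using submodule.m_closed[OF sub g] by blast
    moreover have "?g \<oplus>\<^bsub>?F\<^esub> (f s \<odot>\<^bsub>?F\<^esub> free_gen K s) = f"
      using insert.prems(2) by (auto simp: free_space_def free_gen_def)
    ultimately show ?case by simp
  qed
  have "carrier ?F \<subseteq> ?S"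
    using *[of "{x. f x \<noteq> \<zero>\<^bsub>K\<^esub>}" f for f] by (auto simp: free_space_def)
  then show ?thesis using F.span_is_subset2[OF gX] by auto
qed

text \<open>Evaluating a linear combination of the generators at a point returns the coefficient of that point,
so the generators are linearly independent.\<close>

lemma dim_free_space:
  assumes "field K" "finite X"
  shows "vectorspace.fin_dim K (free_space K X)"
    and "vectorspace.dim K (free_space K X) = card X"
proof -
  interpret K: field K by fact
  let ?F = "free_space K X"
  interpret F: vectorspace K ?F by (rule free_space_vectorspace) fact
  have gX: "free_gen K ` X \<subseteq> carrier ?F" using free_gen_closed[OF assms(1)] by auto
  have inj: "inj_on (free_gen K) X"
  proof (rule inj_onI)
    fix x y assume "free_gen K x = free_gen K y"
    then have "free_gen K x x = free_gen K y x" by simp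
    then show "x = y" by (simp add: free_gen_def split: if_splits)
  qed
  show "vectorspace.fin_dim K (free_space K X)"
    unfolding F.fin_dim_def
    by (intro exI[of _ "free_gen K ` X"] conjI) (use gX span_free_gen[OF assms(1)] assms(2) in simp_all)
  have "F.lin_indpt (free_gen K ` X)"
  proof (rule F.finite_lin_indpt2)
    fix a assume a: "a \<in> free_gen K ` X \<rightarrow> carrier K" and z: "F.lincomb a (free_gen K ` X) = \<zero>\<^bsub>?F\<^esub>"
    have ev: "F.lincomb a (free_gen K ` S) x = (if x \<in> S then a (free_gen K x) else \<zero>\<^bsub>K\<^esub>)"
      if "S \<subseteq> X" for S x
      using finite_subset[OF that assms(2)] that
    proof (induction S)
      case empty
      have "F.lincomb a {} = \<zero>\<^bsub>?F\<^esub>" by simp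
      then show ?case by (simp add: free_space_def)
    next
      case (insert s S)
      have aS: "a \<in> free_gen K ` S \<rightarrow> carrier K" and s: "a (free_gen K s) \<in> carrier K"
        using a insert.prems by auto
      have gS: "free_gen K ` S \<subseteq> carrier ?F" "free_gen K s \<in> carrier ?F"
        using gX insert.prems by blast+
      have "free_gen K s \<notin> free_gen K ` S"
        using inj insert by (auto simp: inj_on_def)
      then have "F.lincomb a (free_gen K ` insert s S)
        = a (free_gen K s) \<odot>\<^bsub>?F\<^esub> free_gen K s \<oplus>\<^bsub>?F\<^esub> F.lincomb a (free_gen K ` S)"
        using F.lincomb_insert2[of "free_gen K ` S" a "free_gen K s"] insert.hyps gS aS s by auto
      then have "F.lincomb a (free_gen K ` insert s S) x
        = a (free_gen K s) \<otimes>\<^bsub>K\<^esub> free_gen K s x \<oplus>\<^bsub>K\<^esub> F.lincomb a (free_gen K ` S) x"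
        by (simp add: free_space_def)
      moreover have "x \<in> S \<Longrightarrow> a (free_gen K x) \<in> carrier K" using a insert.prems by auto
      ultimately show ?case using insert s by (auto simp: free_gen_def)
    qed
    show "\<forall>v\<in>free_gen K ` X. a v = \<zero>\<^bsub>K\<^esub>"
    proof (safe)
      fix x assume "x \<in> X"
      then have "a (free_gen K x) = F.lincomb a (free_gen K ` X) x" by (simp add: ev)
      also have "\<dots> = \<zero>\<^bsub>K\<^esub>" by (simp add: z) (simp add: free_space_def)
      finally show "a (free_gen K x) = \<zero>\<^bsub>K\<^esub>" .
    qed
  qed (use assms gX in auto)
  then have "F.basis (free_gen K ` X)" 
    unfolding F.basis_def using span_free_gen[OF assms(1)] gX by auto
  then show "F.dim = card X"
    using F.dim_basis[of "free_gen K ` X"] assms(2) inj by (simp add: card_image)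
qed

lemma lin_ext_zero_family:
  assumes "vectorspace K V" and "f \<in> carrier (free_space K X)" and "\<And>x. x \<in> X \<Longrightarrow> \<phi> x = \<zero>\<^bsub>V\<^esub>"
  shows "lin_ext K V \<phi> f = \<zero>\<^bsub>V\<^esub>"
proof -
  interpret V: vectorspace K V by fact
  have f: "f x \<in> carrier K" "{x. f x \<noteq> \<zero>\<^bsub>K\<^esub>} \<subseteq> X" for x
    using assms(2) by (auto simp: free_space_def)
  have "f x \<odot>\<^bsub>V\<^esub> \<phi> x = \<zero>\<^bsub>V\<^esub>" if "f x \<noteq> \<zero>\<^bsub>K\<^esub>" for x
  proof -
    have "x \<in> X" using f(2) that by auto
    then show ?thesis using f(1) assms(3) by simp
  qed
  then show ?thesis
    unfolding lin_ext_def by (intro V.add.finprod_one_eqI) auto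
qed

section \<open>Exterior powers\<close>

lemma (in abelian_group) add_minus_minus_cancel:
  assumes "a \<in> carrier G" "b \<in> carrier G"
  shows "a \<oplus> b \<ominus> a \<ominus> b = \<zero>"
proof -
  have "a \<oplus> b = b \<oplus> a" using assms by (rule a_comm)
  then show ?thesis using assms by (simp add: minus_eq a_assoc r_neg r_neg2)
qed

lemma (in abelian_group) minus_minus_eq_zeroD:
  assumes "a \<ominus> b \<ominus> c = \<zero>" "a \<in> carrier G" "b \<in> carrier G" "c \<in> carrier G"
  shows "a = b \<oplus> c"
proof -
  have "a \<ominus> b = c" using assms minus_other_side[of "a \<ominus> b" c] by simp
  moreover have "a = (a \<ominus> b) \<oplus> b" using assms by (simp add: minus_eq a_assoc l_neg)
  ultimately show ?thesis using assms a_comm by simp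
qed

context vectorspace
begin

abbreviation tuple_space where "tuple_space p \<equiv> free_space K (tuples p V)"

lemma tuple_space_vectorspace: "vectorspace K (tuple_space p)"
  by (rule free_space_vectorspace) (rule field_axioms)

lemma free_gen_tuple_closed: "xs \<in> tuples p V \<Longrightarrow> free_gen K xs \<in> carrier (tuple_space p)"
  by (rule free_gen_closed) (rule field_axioms)

lemma tuples_replace:
  assumes "us @ [x] @ ws \<in> tuples p V" "y \<in> carrier V"
  shows "us @ [y] @ ws \<in> tuples p V"
  using assms by (auto simp: tuples_def)

lemma ext_relations_closed: "ext_relations K p V \<subseteq> carrier (tuple_space p)"
proof -
  interpret F: vectorspace K "tuple_space p" by (rule tuple_space_vectorspace)
  have "x \<in> carrier V" if "us @ [x] @ ws \<in> tuples p V" for us ws x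
    using that by (auto simp: tuples_def)
  then show ?thesis
    unfolding ext_relations_def Let_def
    by (auto intro!: F.M.minus_closed F.smult_closed free_gen_tuple_closed
        intro: tuples_replace[simplified] a_closed smult_closed)
qed

lemma ext_null_subspace: "subspace K (ext_null K p V) (tuple_space p)"
proof -
  interpret F: vectorspace K "tuple_space p" by (rule tuple_space_vectorspace)
  show ?thesis unfolding ext_null_def by (rule F.span_is_subspace[OF ext_relations_closed])
qed

lemma ext_power_is_quotient: "is_quotient (tuple_space p) (ext_null K p V) (ext_power K p V)"
  unfolding ext_power_def by (rule is_quotient_quot_space)

lemmas ext_power_vectorspace = quotient_vectorspace[OF ext_null_subspace ext_power_is_quotient]
  and ext_power_linear_map = quotient_linear_map[OF ext_null_subspace ext_power_is_quotient]
  and ext_power_carrier = quotient_carrier[OF ext_null_subspace ext_power_is_quotient]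
  and ext_power_zero = quotient_zero[OF ext_null_subspace ext_power_is_quotient]
  and ext_power_coset_zero = coset_eq_zero_iff[OF ext_null_subspace ext_power_is_quotient]
  and ext_power_coset_subset = coset_subset[OF ext_null_subspace ext_power_is_quotient]

lemma wedge_eq_coset:
  "xs \<in> tuples p V \<Longrightarrow> wedge K V xs = ext_null K p V +>\<^bsub>tuple_space p\<^esub> free_gen K xs"
  by (auto simp: wedge_def tuples_def)

lemma wedge_closed: "xs \<in> tuples p V \<Longrightarrow> wedge K V xs \<in> carrier (ext_power K p V)"
  using free_gen_tuple_closed by (auto simp: wedge_eq_coset ext_power_carrier)

lemma relation_in_ext_null: "r \<in> ext_relations K p V \<Longrightarrow> r \<in> ext_null K p V"
proof -
  interpret F: vectorspace K "tuple_space p" by (rule tuple_space_vectorspace)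
  show "r \<in> ext_relations K p V \<Longrightarrow> r \<in> ext_null K p V"
    unfolding ext_null_def using F.in_own_span[OF ext_relations_closed] by auto
qed

lemma wedge_add:
  assumes x: "us @ [x] @ ws \<in> tuples p V" and y: "y \<in> carrier V"
  shows "wedge K V (us @ [x \<oplus>\<^bsub>V\<^esub> y] @ ws)
    = wedge K V (us @ [x] @ ws) \<oplus>\<^bsub>ext_power K p V\<^esub> wedge K V (us @ [y] @ ws)"
proof -
  let ?F = "tuple_space p" and ?E = "ext_power K p V" and ?N = "ext_null K p V"
  interpret F: vectorspace K ?F by (rule tuple_space_vectorspace)
  interpret E: vectorspace K ?E by (rule ext_power_vectorspace)
  interpret T: linear_map K ?F ?E "\<lambda>f. ?N +>\<^bsub>?F\<^esub> f" by (rule ext_power_linear_map)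
  have xV: "x \<in> carrier V" using x by (auto simp: tuples_def)
  have t: "us @ [y] @ ws \<in> tuples p V" "us @ [x \<oplus>\<^bsub>V\<^esub> y] @ ws \<in> tuples p V"
    using tuples_replace[OF x] xV y by auto
  note g = free_gen_tuple_closed[OF x] free_gen_tuple_closed[OF t(1)] free_gen_tuple_closed[OF t(2)]
  have r: "free_gen K (us @ [x \<oplus>\<^bsub>V\<^esub> y] @ ws) \<ominus>\<^bsub>?F\<^esub> free_gen K (us @ [x] @ ws)
      \<ominus>\<^bsub>?F\<^esub> free_gen K (us @ [y] @ ws) \<in> ?N" (is "?r \<in> _")
    by (rule relation_in_ext_null) (use x y in \<open>unfold ext_relations_def Let_def, blast\<close>)
  have "?r \<in> carrier ?F" using g by (intro F.M.minus_closed)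
  then have "?N +>\<^bsub>?F\<^esub> ?r = \<zero>\<^bsub>?E\<^esub>"
    using r by (simp only: ext_power_coset_zero ext_power_zero)
  then have "wedge K V (us @ [x \<oplus>\<^bsub>V\<^esub> y] @ ws) \<ominus>\<^bsub>?E\<^esub> wedge K V (us @ [x] @ ws)
      \<ominus>\<^bsub>?E\<^esub> wedge K V (us @ [y] @ ws) = \<zero>\<^bsub>?E\<^esub>"
    using g by (simp only: T.T_minus F.M.minus_closed wedge_eq_coset[OF x] wedge_eq_coset[OF t(1)] wedge_eq_coset[OF t(2)])
  then show ?thesis
    using wedge_closed[OF x] wedge_closed[OF t(1)] wedge_closed[OF t(2)]
    by (intro E.M.minus_minus_eq_zeroD)
qed

lemma wedge_smult:
  assumes x: "us @ [x] @ ws \<in> tuples p V" and a: "a \<in> carrier K"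
  shows "wedge K V (us @ [a \<odot>\<^bsub>V\<^esub> x] @ ws) = a \<odot>\<^bsub>ext_power K p V\<^esub> wedge K V (us @ [x] @ ws)"
proof -
  let ?F = "tuple_space p" and ?E = "ext_power K p V" and ?N = "ext_null K p V"
  interpret F: vectorspace K ?F by (rule tuple_space_vectorspace)
  interpret E: vectorspace K ?E by (rule ext_power_vectorspace)
  interpret T: linear_map K ?F ?E "\<lambda>f. ?N +>\<^bsub>?F\<^esub> f" by (rule ext_power_linear_map)
  have xV: "x \<in> carrier V" using x by (auto simp: tuples_def)
  have t: "us @ [a \<odot>\<^bsub>V\<^esub> x] @ ws \<in> tuples p V"
    using tuples_replace[OF x] xV a by auto
  note g = free_gen_tuple_closed[OF x] free_gen_tuple_closed[OF t]
  have r: "free_gen K (us @ [a \<odot>\<^bsub>V\<^esub> x] @ ws) \<ominus>\<^bsub>?F\<^esub> (a \<odot>\<^bsub>?F\<^esub> free_gen K (us @ [x] @ ws)) \<in> ?N"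
    (is "?r \<in> _")
    by (rule relation_in_ext_null) (use x a in \<open>unfold ext_relations_def Let_def, blast\<close>)
  have "?r \<in> carrier ?F" using g a by (intro F.M.minus_closed F.smult_closed)
  then have "?N +>\<^bsub>?F\<^esub> ?r = \<zero>\<^bsub>?E\<^esub>"
    using r by (simp only: ext_power_coset_zero ext_power_zero)
  then have "wedge K V (us @ [a \<odot>\<^bsub>V\<^esub> x] @ ws) \<ominus>\<^bsub>?E\<^esub> a \<odot>\<^bsub>?E\<^esub> wedge K V (us @ [x] @ ws) = \<zero>\<^bsub>?E\<^esub>"
    using g a by (simp only: T.T_minus T.T_smult F.smult_closed wedge_eq_coset[OF x] wedge_eq_coset[OF t])
  then show ?thesis
    using wedge_closed[OF x] wedge_closed[OF t] a by (subst (asm) E.M.minus_other_side) auto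
qed

lemma wedge_repeated:
  assumes "xs \<in> tuples p V" "\<not> distinct xs"
  shows "wedge K V xs = \<zero>\<^bsub>ext_power K p V\<^esub>"
proof -
  have "free_gen K xs \<in> ext_null K p V"
    by (rule relation_in_ext_null) (use assms in \<open>unfold ext_relations_def Let_def, blast\<close>)
  then show ?thesis
    using ext_power_coset_zero[OF free_gen_tuple_closed[OF assms(1)]]
    by (simp add: wedge_eq_coset[OF assms(1)] ext_power_zero)
qed

text \<open>The wedges generate the exterior power; in this form the fact serves as an induction principle.\<close>

lemma ext_power_subset_if_wedges:
  assumes S: "LinearCombinations.submodule K S (ext_power K p V)"
    and w: "\<And>xs. xs \<in> tuples p V \<Longrightarrow> wedge K V xs \<in> S"
  shows "carrier (ext_power K p V) \<subseteq> S"
proof -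
  let ?F = "tuple_space p" and ?N = "ext_null K p V"
  interpret F: vectorspace K ?F by (rule tuple_space_vectorspace)
  have "F.span (free_gen K ` tuples p V) \<subseteq> {f \<in> carrier ?F. ?N +>\<^bsub>?F\<^esub> f \<in> S}"
    by (rule F.span_is_subset[OF _ linear_map_preimage[OF ext_power_linear_map S]])
      (use w free_gen_tuple_closed in \<open>auto simp: wedge_eq_coset\<close>)
  then show ?thesis
    by (auto simp: span_free_gen[OF field_axioms] ext_power_carrier)
qed

text \<open>The universal property of the exterior power, on representatives: a multilinear alternating map
kills every defining relation, hence their span. Values of such maps separate wedges.\<close>

lemma lin_ext_ext_null:
  assumes W: "vectorspace K W" and \<phi>: "\<phi> \<in> tuples p V \<rightarrow> carrier W"
    and add: "\<And>us ws x y. us @ [x] @ ws \<in> tuples p V \<Longrightarrow> y \<in> carrier V \<Longrightarrow>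
      \<phi> (us @ [x \<oplus>\<^bsub>V\<^esub> y] @ ws) = \<phi> (us @ [x] @ ws) \<oplus>\<^bsub>W\<^esub> \<phi> (us @ [y] @ ws)"
    and smult: "\<And>us ws a x. us @ [x] @ ws \<in> tuples p V \<Longrightarrow> a \<in> carrier K \<Longrightarrow>
      \<phi> (us @ [a \<odot>\<^bsub>V\<^esub> x] @ ws) = a \<odot>\<^bsub>W\<^esub> \<phi> (us @ [x] @ ws)"
    and alt: "\<And>xs. xs \<in> tuples p V \<Longrightarrow> \<not> distinct xs \<Longrightarrow> \<phi> xs = \<zero>\<^bsub>W\<^esub>"
    and f: "f \<in> ext_null K p V"
  shows "lin_ext K W \<phi> f = \<zero>\<^bsub>W\<^esub>"
proof -
  let ?F = "tuple_space p" and ?D = "lin_ext K W \<phi>"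
  interpret F: vectorspace K ?F by (rule tuple_space_vectorspace)
  interpret W: vectorspace K W by (rule W)
  interpret D: linear_map K ?F W ?D by (rule lin_ext_linear_map[OF W \<phi>])
  have D: "?D (free_gen K xs) = \<phi> xs" if "xs \<in> tuples p V" for xs
    using lin_ext_free_gen[OF W, of \<phi> xs] \<phi> that by auto
  have \<phi>W: "\<phi> xs \<in> carrier W" if "xs \<in> tuples p V" for xs using \<phi> that by auto
  have "?D r = \<zero>\<^bsub>W\<^esub>" if r: "r \<in> ext_relations K p V" for r
  proof -
    consider (add) us ws x y where "us @ [x] @ ws \<in> tuples p V" "y \<in> carrier V"
        "r = free_gen K (us @ [x \<oplus>\<^bsub>V\<^esub> y] @ ws) \<ominus>\<^bsub>?F\<^esub> free_gen K (us @ [x] @ ws)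
          \<ominus>\<^bsub>?F\<^esub> free_gen K (us @ [y] @ ws)"
      | (smult) us ws a x where "us @ [x] @ ws \<in> tuples p V" "a \<in> carrier K"
        "r = free_gen K (us @ [a \<odot>\<^bsub>V\<^esub> x] @ ws) \<ominus>\<^bsub>?F\<^esub> (a \<odot>\<^bsub>?F\<^esub> free_gen K (us @ [x] @ ws))"
      | (alt) xs where "xs \<in> tuples p V" "\<not> distinct xs" "r = free_gen K xs"
      using r[unfolded ext_relations_def Let_def] by blast
    then show ?thesis
    proof cases
      case add
      have xV: "x \<in> carrier V" using add(1) by (auto simp: tuples_def)
      have t: "us @ [y] @ ws \<in> tuples p V" "us @ [x \<oplus>\<^bsub>V\<^esub> y] @ ws \<in> tuples p V"
        using tuples_replace[OF add(1)] xV add(2) by auto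
      note g = free_gen_tuple_closed[OF add(1)] free_gen_tuple_closed[OF t(1)] free_gen_tuple_closed[OF t(2)]
      have "?D r = (\<phi> (us @ [x] @ ws) \<oplus>\<^bsub>W\<^esub> \<phi> (us @ [y] @ ws)) \<ominus>\<^bsub>W\<^esub> \<phi> (us @ [x] @ ws) \<ominus>\<^bsub>W\<^esub> \<phi> (us @ [y] @ ws)"
        unfolding add(3) assms(3)[OF add(1,2), symmetric] using g
        by (simp only: D.T_minus F.M.minus_closed D[OF add(1)] D[OF t(1)] D[OF t(2)])
      also have "\<dots> = \<zero>\<^bsub>W\<^esub>"
        using \<phi>W[OF add(1)] \<phi>W[OF t(1)] by (rule W.M.add_minus_minus_cancel)
      finally show ?thesis .
    next
      case smult
      have xV: "x \<in> carrier V" using smult(1) by (auto simp: tuples_def)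
      have t: "us @ [a \<odot>\<^bsub>V\<^esub> x] @ ws \<in> tuples p V"
        using tuples_replace[OF smult(1)] xV smult(2) by auto
      note g = free_gen_tuple_closed[OF smult(1)] free_gen_tuple_closed[OF t]
      have "?D r = a \<odot>\<^bsub>W\<^esub> \<phi> (us @ [x] @ ws) \<ominus>\<^bsub>W\<^esub> a \<odot>\<^bsub>W\<^esub> \<phi> (us @ [x] @ ws)"
        unfolding smult(3) assms(4)[OF smult(1,2), symmetric] using g smult(2)
        by (simp only: D.T_minus D.T_smult F.smult_closed D[OF smult(1)] D[OF t] assms(4)[OF smult(1,2)])
      also have "\<dots> = \<zero>\<^bsub>W\<^esub>"
        using \<phi>W[OF smult(1)] smult(2) by (simp add: W.M.minus_eq W.M.r_neg)
      finally show ?thesis .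
    next
      case alt
      then show ?thesis using D assms(5) by simp
    qed
  qed
  moreover have "LinearCombinations.submodule K {v \<in> carrier ?F. ?D v \<in> {\<zero>\<^bsub>W\<^esub>}} ?F"
    by (rule linear_map_preimage[OF D.linear_map_axioms]) (auto simp: submodule_def W.module_axioms)
  ultimately have "F.span (ext_relations K p V) \<subseteq> {v \<in> carrier ?F. ?D v \<in> {\<zero>\<^bsub>W\<^esub>}}"
    using ext_relations_closed by (intro F.span_is_subset) auto
  then show ?thesis using f by (auto simp: ext_null_def)
qed

end
section \<open>The dimension of the exterior square\<close>

lemma tuples_2_iff: "xs \<in> tuples 2 V \<longleftrightarrow> (\<exists>x\<in>carrier V. \<exists>y\<in>carrier V. xs = [x, y])"
  by (auto simp: tuples_def numeral_2_eq_2 length_Suc_conv)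

lemma split_2_cases:
  assumes "us @ [x] @ ws \<in> tuples 2 V"
  obtains (first) z where "us = []" "ws = [z]" "x \<in> carrier V" "z \<in> carrier V"
    | (second) z where "us = [z]" "ws = []" "x \<in> carrier V" "z \<in> carrier V"
  using assms by (cases us) (auto simp: tuples_2_iff append_eq_Cons_conv)

lemma card_pairs_below: "card (SIGMA j:{..<q}. {..<j}) = q choose 2" for q :: nat
proof -
  have "card (SIGMA j:{..<q}. {..<j}) = (\<Sum>j<q. j)" by simp
  also have "\<dots> = q choose 2" by (induction q) (simp_all add: numeral_2_eq_2)
  finally show ?thesis .
qed

text \<open>The next three facts say that a two by two determinant is linear in each of its columns and
alternating. Its entries will be coordinates of a pair of vectors.\<close>

lemma (in cring) det2_add:
  "\<lbrakk>a \<in> carrier R; a' \<in> carrier R; b \<in> carrier R; c \<in> carrier R; c' \<in> carrier R; d \<in> carrier R\<rbrakk> \<Longrightarrow>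
    (a \<oplus> a') \<otimes> b \<ominus> (c \<oplus> c') \<otimes> d = (a \<otimes> b \<ominus> c \<otimes> d) \<oplus> (a' \<otimes> b \<ominus> c' \<otimes> d)"
  "\<lbrakk>a \<in> carrier R; a' \<in> carrier R; b \<in> carrier R; c \<in> carrier R; c' \<in> carrier R; d \<in> carrier R\<rbrakk> \<Longrightarrow>
    b \<otimes> (a \<oplus> a') \<ominus> d \<otimes> (c \<oplus> c') = (b \<otimes> a \<ominus> d \<otimes> c) \<oplus> (b \<otimes> a' \<ominus> d \<otimes> c')"
  by (simp_all add: minus_eq l_distr r_distr minus_add a_ac)

lemma (in cring) det2_mult:
  "\<lbrakk>r \<in> carrier R; a \<in> carrier R; b \<in> carrier R; c \<in> carrier R; d \<in> carrier R\<rbrakk> \<Longrightarrow>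
    (r \<otimes> a) \<otimes> b \<ominus> (r \<otimes> c) \<otimes> d = r \<otimes> (a \<otimes> b \<ominus> c \<otimes> d)"
  "\<lbrakk>r \<in> carrier R; a \<in> carrier R; b \<in> carrier R; c \<in> carrier R; d \<in> carrier R\<rbrakk> \<Longrightarrow>
    b \<otimes> (r \<otimes> a) \<ominus> d \<otimes> (r \<otimes> c) = r \<otimes> (b \<otimes> a \<ominus> d \<otimes> c)"
  by (simp_all add: minus_eq r_distr r_minus m_ac)

lemma (in cring) det2_self:
  "\<lbrakk>a \<in> carrier R; b \<in> carrier R\<rbrakk> \<Longrightarrow> a \<otimes> b \<ominus> b \<otimes> a = \<zero>"
  by (simp add: minus_eq m_comm[of b a] r_neg)

context vectorspace
begin

abbreviation ext_square where "ext_square \<equiv> ext_power K 2 V"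

lemma wedge2_closed: "x \<in> carrier V \<Longrightarrow> y \<in> carrier V \<Longrightarrow> wedge K V [x, y] \<in> carrier ext_square"
  by (rule wedge_closed) (auto simp: tuples_2_iff)

lemma wedge2_add:
  assumes "x \<in> carrier V" "y \<in> carrier V" "z \<in> carrier V"
  shows "wedge K V [x \<oplus>\<^bsub>V\<^esub> y, z] = wedge K V [x, z] \<oplus>\<^bsub>ext_square\<^esub> wedge K V [y, z]"
    and "wedge K V [z, x \<oplus>\<^bsub>V\<^esub> y] = wedge K V [z, x] \<oplus>\<^bsub>ext_square\<^esub> wedge K V [z, y]"
  using wedge_add[of "[]" x "[z]" 2 y] wedge_add[of "[z]" x "[]" 2 y] assms
  by (simp_all add: tuples_2_iff)

lemma wedge2_smult:
  assumes "a \<in> carrier K" "x \<in> carrier V" "z \<in> carrier V"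
  shows "wedge K V [a \<odot>\<^bsub>V\<^esub> x, z] = a \<odot>\<^bsub>ext_square\<^esub> wedge K V [x, z]"
    and "wedge K V [z, a \<odot>\<^bsub>V\<^esub> x] = a \<odot>\<^bsub>ext_square\<^esub> wedge K V [z, x]"
  using wedge_smult[of "[]" x "[z]" 2 a] wedge_smult[of "[z]" x "[]" 2 a] assms
  by (simp_all add: tuples_2_iff)

lemma wedge2_self: "x \<in> carrier V \<Longrightarrow> wedge K V [x, x] = \<zero>\<^bsub>ext_square\<^esub>"
  by (rule wedge_repeated) (auto simp: tuples_2_iff)

lemma wedge2_zero:
  assumes "z \<in> carrier V"
  shows "wedge K V [\<zero>\<^bsub>V\<^esub>, z] = \<zero>\<^bsub>ext_square\<^esub>" and "wedge K V [z, \<zero>\<^bsub>V\<^esub>] = \<zero>\<^bsub>ext_square\<^esub>"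
proof -
  interpret E: vectorspace K ext_square by (rule ext_power_vectorspace)
  show "wedge K V [\<zero>\<^bsub>V\<^esub>, z] = \<zero>\<^bsub>ext_square\<^esub>" "wedge K V [z, \<zero>\<^bsub>V\<^esub>] = \<zero>\<^bsub>ext_square\<^esub>"
    using wedge2_smult[of "\<zero>\<^bsub>K\<^esub>" z z] wedge2_smult[of "\<zero>\<^bsub>K\<^esub>" "\<zero>\<^bsub>V\<^esub>" z] assms
      wedge2_closed[OF assms M.zero_closed] wedge2_closed[OF M.zero_closed assms]
    by (simp_all add: E.lmult_0 lmult_0)
qed

text \<open>Expand the vanishing wedge \<open>(x + y) \<and> (x + y)\<close>.\<close>

lemma wedge2_swap:
  assumes "x \<in> carrier V" "y \<in> carrier V"
  shows "wedge K V [y, x] = \<ominus>\<^bsub>ext_square\<^esub> wedge K V [x, y]"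
proof -
  interpret E: vectorspace K ext_square by (rule ext_power_vectorspace)
  have "wedge K V [y, x] \<oplus>\<^bsub>ext_square\<^esub> wedge K V [x, y] = wedge K V [x \<oplus>\<^bsub>V\<^esub> y, x \<oplus>\<^bsub>V\<^esub> y]"
    using assms by (simp add: wedge2_add wedge2_self[OF assms(1)] wedge2_self[OF assms(2)] wedge2_closed E.M.a_ac)
  also have "\<dots> = \<zero>\<^bsub>ext_square\<^esub>" using assms by (simp add: wedge2_self)
  finally show ?thesis
    using assms by (simp add: E.M.minus_equality wedge2_closed)
qed

text \<open>For a fixed second factor the first factors whose wedge lies in \<open>S\<close> form a subspace, and
likewise with the factors exchanged; so one may pass from basis vectors to all vectors in one
factor after the other.\<close>

lemma ext_square_subset_if_basis_wedges:
  assumes S: "LinearCombinations.submodule K S ext_square"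
    and B: "B \<subseteq> carrier V" "span B = carrier V"
    and w: "\<And>b c. b \<in> B \<Longrightarrow> c \<in> B \<Longrightarrow> wedge K V [b, c] \<in> S"
  shows "carrier ext_square \<subseteq> S"
proof (rule ext_power_subset_if_wedges[OF S])
  have zero: "\<zero>\<^bsub>ext_square\<^esub> \<in> S" by (rule submodule.zero_closed[OF S])
  have 1: "wedge K V [x, c] \<in> S" if x: "x \<in> carrier V" and c: "c \<in> B" for x c
  proof -
    have cV: "c \<in> carrier V" using c B by auto
    have "LinearCombinations.submodule K {x \<in> carrier V. wedge K V [x, c] \<in> S} V"
      using S zero cV
      by (auto simp: submodule_def wedge2_add wedge2_smult wedge2_zero intro: module_axioms)
    then have "span B \<subseteq> {x \<in> carrier V. wedge K V [x, c] \<in> S}"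
      by (rule span_is_subset[rotated]) (use B w c in auto)
    then show ?thesis using x B(2) by auto
  qed
  have 2: "wedge K V [x, y] \<in> S" if x: "x \<in> carrier V" and y: "y \<in> carrier V" for x y
  proof -
    have "LinearCombinations.submodule K {y \<in> carrier V. wedge K V [x, y] \<in> S} V"
      using S zero x
      by (auto simp: submodule_def wedge2_add wedge2_smult wedge2_zero intro: module_axioms)
    then have "span B \<subseteq> {y \<in> carrier V. wedge K V [x, y] \<in> S}"
      by (rule span_is_subset[rotated]) (use B 1 x in auto)
    then show ?thesis using y B(2) by auto
  qed
  fix xs assume "xs \<in> tuples 2 V"
  then show "wedge K V xs \<in> S" using 2 by (auto simp: tuples_2_iff)
qed

text \<open>The wedges \<open>e i \<and> e j\<close> with \<open>i < j\<close> form a basis of the exterior square. This is expressed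
by a linear bijection \<open>T\<close> from the free space on the pairs onto the exterior square. It is onto
because wedges of basis vectors generate. It is injective because the two by two minors of the
coordinate matrix of a pair of vectors define a map \<open>D\<close> in the opposite direction that vanishes on
the relations and recovers an element of the free space from any representative of its image.\<close>

lemma dim_ext_square:
  assumes fd: "fin_dim"
  shows "vectorspace.fin_dim K ext_square"
    and "vectorspace.dim K ext_square = dim choose 2"
proof -
  obtain B where B: "finite B" "basis B" using finite_basis_exists[OF fd] by auto
  have BV: "B \<subseteq> carrier V" and spanB: "span B = carrier V" using B(2) by (auto simp: basis_def)
  define q where "q = card B"
  have q: "dim = q" using dim_basis[OF B] by (simp add: q_def)
  obtain e where e: "bij_betw e {0..<q} B" using ex_bij_betw_nat_finite[OF B(1)] by (auto simp: q_def)
  have eB: "e i \<in> B" if "i < q" for i using bij_betwE[OF e] that by simp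
  have eV: "e i \<in> carrier V" if "i < q" for i using eB[OF that] BV by auto
  have e_inj: "e i = e j \<longleftrightarrow> i = j" if "i < q" "j < q" for i j
    using inj_on_eq_iff[OF bij_betw_imp_inj_on[OF e]] that by simp
  obtain c where c: "\<And>v b. v \<in> carrier V \<Longrightarrow> b \<in> B \<Longrightarrow> c v b \<in> carrier K"
    "\<And>u v b. u \<in> carrier V \<Longrightarrow> v \<in> carrier V \<Longrightarrow> b \<in> B \<Longrightarrow> c (u \<oplus>\<^bsub>V\<^esub> v) b = c u b \<oplus>\<^bsub>K\<^esub> c v b"
    "\<And>a v b. a \<in> carrier K \<Longrightarrow> v \<in> carrier V \<Longrightarrow> b \<in> B \<Longrightarrow> c (a \<odot>\<^bsub>V\<^esub> v) b = a \<otimes>\<^bsub>K\<^esub> c v b"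
    "\<And>b b'. b \<in> B \<Longrightarrow> b' \<in> B \<Longrightarrow> c b b' = (if b' = b then \<one>\<^bsub>K\<^esub> else \<zero>\<^bsub>K\<^esub>)"
    by (rule coordinates[OF B]) blast
  (* The larger index comes first, which makes P a dependent sum of initial segments. *)
  define P where "P = (SIGMA j:{..<q}. {..<j})"
  have P: "finite P" "card P = q choose 2" by (simp_all add: P_def card_pairs_below)
  have inP: "(j, i) \<in> P \<longleftrightarrow> j < q \<and> i < j" for i j by (simp add: P_def)
  (* The minors of the 2 x q matrix of coordinates of a pair of vectors. *)
  define \<phi> where "\<phi> xs = (\<lambda>(j, i). if (j, i) \<in> P
      then c (xs ! 0) (e i) \<otimes>\<^bsub>K\<^esub> c (xs ! 1) (e j) \<ominus>\<^bsub>K\<^esub> c (xs ! 0) (e j) \<otimes>\<^bsub>K\<^esub> c (xs ! 1) (e i)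
      else \<zero>\<^bsub>K\<^esub>)" for xs
  let ?F = "tuple_space 2" and ?E = ext_square and ?N = "ext_null K 2 V" and ?C = "free_space K P"
  interpret F: vectorspace K ?F by (rule tuple_space_vectorspace)
  interpret E: vectorspace K ?E by (rule ext_power_vectorspace)
  interpret C: vectorspace K ?C by (rule free_space_vectorspace) (rule field_axioms)
  have c_closed: "c v (e i) \<in> carrier K" if "v \<in> carrier V" "i < q" for v i
    using c(1)[OF that(1) eB[OF that(2)]] .
  have \<phi>_closed: "\<phi> \<in> tuples 2 V \<rightarrow> carrier ?C"
  proof
    fix xs assume "xs \<in> tuples 2 V"
    then obtain x y where xs: "xs = [x, y]" "x \<in> carrier V" "y \<in> carrier V"
      by (auto simp: tuples_2_iff)
    have "{t. \<phi> xs t \<noteq> \<zero>\<^bsub>K\<^esub>} \<subseteq> P" by (auto simp: \<phi>_def split: if_splits)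
    then show "\<phi> xs \<in> carrier ?C"
      using xs(2,3) finite_subset[OF _ P(1)]
      by (auto simp: free_space_def xs(1) \<phi>_def inP c_closed)
  qed
  have \<phi>_add: "\<phi> (us @ [x \<oplus>\<^bsub>V\<^esub> y] @ ws) = \<phi> (us @ [x] @ ws) \<oplus>\<^bsub>?C\<^esub> \<phi> (us @ [y] @ ws)"
    if x: "us @ [x] @ ws \<in> tuples 2 V" and y: "y \<in> carrier V" for us ws x y
    using x
    by (cases rule: split_2_cases)
      (use y in \<open>auto simp: free_space_def \<phi>_def fun_eq_iff inP c(2) eB c_closed det2_add\<close>)
  have \<phi>_smult: "\<phi> (us @ [a \<odot>\<^bsub>V\<^esub> x] @ ws) = a \<odot>\<^bsub>?C\<^esub> \<phi> (us @ [x] @ ws)"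
    if x: "us @ [x] @ ws \<in> tuples 2 V" and a: "a \<in> carrier K" for us ws x a
    using x
    by (cases rule: split_2_cases)
      (use a in \<open>auto simp: free_space_def \<phi>_def fun_eq_iff inP c(3) eB c_closed det2_mult\<close>)
  have \<phi>_alt: "\<phi> xs = \<zero>\<^bsub>?C\<^esub>" if "xs \<in> tuples 2 V" "\<not> distinct xs" for xs
    using that by (auto simp: tuples_2_iff free_space_def \<phi>_def fun_eq_iff inP c_closed det2_self)
  have \<phi>_basis: "\<phi> [e i, e j] = free_gen K (j, i)" if "(j, i) \<in> P" for i j
    using that
    by (auto simp: \<phi>_def fun_eq_iff inP free_gen_def c(4) eB e_inj a_minus_def)
  (* G lifts T to representatives; D is a left inverse of G and factors through the quotient. *)
  let ?g = "\<lambda>(j, i). free_gen K [e i, e j]"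
  have g_closed: "?g \<in> P \<rightarrow> carrier ?F"
    by (auto simp: inP tuples_2_iff eV intro!: free_gen_tuple_closed)
  let ?G = "lin_ext K ?F ?g" and ?D = "lin_ext K ?C \<phi>" and ?T = "\<lambda>f. ?N +>\<^bsub>?F\<^esub> lin_ext K ?F ?g f"
  have G: "linear_map K ?C ?F ?G" by (rule lin_ext_linear_map[OF F.vectorspace_axioms g_closed])
  have D: "linear_map K ?F ?C ?D" by (rule lin_ext_linear_map[OF C.vectorspace_axioms \<phi>_closed])
  have T: "linear_map K ?C ?E ?T" by (rule linear_map_compose[OF G ext_power_linear_map])
  interpret G: linear_map K ?C ?F ?G by (rule G)
  interpret T: linear_map K ?C ?E ?T by (rule T)
  have Ggen: "?G (free_gen K (j, i)) = free_gen K [e i, e j]" if "(j, i) \<in> P" for i j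
  proof -
    have "?g (j, i) \<in> carrier ?F" using g_closed that by blast
    then show ?thesis using lin_ext_free_gen[OF F.vectorspace_axioms, of ?g "(j, i)"] by simp
  qed
  have t: "[e i, e j] \<in> tuples 2 V" if "(j, i) \<in> P" for i j
    using that by (auto simp: inP tuples_2_iff eV)
  have DG: "?D (?G f) = f" if f: "f \<in> carrier ?C" for f
  proof (rule linear_maps_eq_on_span[OF linear_map_compose[OF G D] linear_map_id[OF C.vectorspace_axioms]])
    show "free_gen K ` P \<subseteq> carrier ?C" using free_gen_closed[OF field_axioms] by auto
    show "f \<in> C.span (free_gen K ` P)" using f by (simp add: span_free_gen[OF field_axioms])
    fix b assume "b \<in> free_gen K ` P"
    then obtain i j where ij: "(j, i) \<in> P" "b = free_gen K (j, i)" by auto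
    have "\<phi> [e i, e j] \<in> carrier ?C" using \<phi>_closed t[OF ij(1)] by auto
    then show "?D (?G b) = b"
      using lin_ext_free_gen[OF C.vectorspace_axioms, of \<phi> "[e i, e j]"] \<phi>_basis[OF ij(1)]
      by (simp add: ij(2) Ggen[OF ij(1)])
  qed
  have ker: "T.kerT = {\<zero>\<^bsub>?C\<^esub>}"
  proof -
    have "f = \<zero>\<^bsub>?C\<^esub>" if f: "f \<in> carrier ?C" "?T f = \<zero>\<^bsub>?E\<^esub>" for f
    proof -
      have "?G f \<in> ?N"
        using ext_power_coset_zero[where v = "?G f"] f by (simp add: ext_power_zero)
      then have "?D (?G f) = \<zero>\<^bsub>?C\<^esub>"
        using lin_ext_ext_null[OF C.vectorspace_axioms \<phi>_closed \<phi>_add \<phi>_smult \<phi>_alt] by blast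
      then show ?thesis using DG[OF f(1)] by simp
    qed
    then have "T.kerT \<subseteq> {\<zero>\<^bsub>?C\<^esub>}" unfolding T.ker_def by blast
    moreover have "\<zero>\<^bsub>?C\<^esub> \<in> T.kerT" by (rule submodule.zero_closed[OF T.ker_is_submodule])
    ultimately show ?thesis by blast
  qed
  have inj: "inj_on ?T (carrier ?C)" by (rule T.Ke0_imp_inj) (simp add: ker)
  have im: "LinearCombinations.submodule K T.imT ?E" by (rule T.im_is_submodule)
  have "carrier ?E \<subseteq> T.imT"
  proof (rule ext_square_subset_if_basis_wedges[OF im BV spanB])
    have up: "wedge K V [e i, e j] \<in> T.imT" if ij: "(j, i) \<in> P" for i j
    proof -
      have "wedge K V [e i, e j] = ?T (free_gen K (j, i))"
        by (simp add: Ggen[OF ij] wedge_eq_coset[OF t[OF ij]])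
      moreover have "free_gen K (j, i) \<in> carrier ?C" by (rule free_gen_closed[OF field_axioms ij])
      ultimately show ?thesis unfolding T.im_def by (rule image_eqI)
    qed
    fix b b' assume b: "b \<in> B" "b' \<in> B"
    have bV: "b \<in> carrier V" "b' \<in> carrier V" using b BV by auto
    have "b \<in> e ` {0..<q}" "b' \<in> e ` {0..<q}"
      using b bij_betw_imp_surj_on[OF e] by simp_all
    then obtain i j where ij: "b = e i" "b' = e j" "i < q" "j < q" by auto
    consider "i < j" | "i = j" | "j < i" by linarith
    then show "wedge K V [b, b'] \<in> T.imT"
    proof cases
      case 1
      then show ?thesis using up[of j i] ij by (simp add: inP)
    next
      case 2
      then show ?thesis using submodule.zero_closed[OF im] ij by (simp add: wedge2_self eV)
    next
      case 3
      then have "wedge K V [b', b] \<in> T.imT" using up[of i j] ij by (simp add: inP)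
      then have "(\<ominus>\<^bsub>K\<^esub> \<one>\<^bsub>K\<^esub>) \<odot>\<^bsub>?E\<^esub> wedge K V [b', b] \<in> T.imT"
        using submodule.smult_closed[OF im] by simp
      then show ?thesis
        by (simp only: wedge2_swap[OF bV(2) bV(1)] E.smult_minus_1[OF wedge2_closed[OF bV(2) bV(1)]])
    qed
  qed
  then have surj: "?T ` carrier ?C = carrier ?E"
    using submodule.subset[OF im] by (auto simp: T.im_def)
  note C_dim = dim_free_space[OF field_axioms P(1)]
  show "E.fin_dim" by (rule T.surj_fin_dim[OF C_dim(1) surj])
  show "E.dim = dim choose 2"
    using T.dim_eq[OF C_dim(1) inj surj] C_dim(2) P(2) q by simp
qed

end

section \<open>The multiplier of an abelian Lie algebra\<close>

text \<open>The differentials are defined by evaluating a linear extension on all representatives of a coset.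
If the extended family vanishes, zero is the only value that occurs.\<close>

lemma (in vectorspace) lin_ext_image_coset:
  assumes "vectorspace K W" and w: "w \<in> carrier (ext_power K p V)"
    and "\<And>xs. xs \<in> tuples p V \<Longrightarrow> \<phi> xs = \<zero>\<^bsub>W\<^esub>"
  shows "lin_ext K W \<phi> ` w = {\<zero>\<^bsub>W\<^esub>}"
proof -
  let ?N = "ext_null K p V" and ?F = "tuple_space p"
  obtain f where f: "f \<in> carrier ?F" "w = ?N +>\<^bsub>?F\<^esub> f"
    using w by (auto simp: ext_power_carrier)
  have "f \<in> w"
    using abelian_subgroup.a_rcos_self[OF subspace_abelian_subgroup[OF ext_null_subspace] f(1)] f(2)
    by simp
  then have "w \<noteq> {}" by auto
  have wF: "w \<subseteq> carrier ?F" using ext_power_coset_subset f by simp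
  have "lin_ext K W \<phi> ` w = (\<lambda>_. \<zero>\<^bsub>W\<^esub>) ` w"
    by (rule image_cong[OF refl], rule lin_ext_zero_family[OF assms(1) subsetD[OF wF] assms(3)])
  with \<open>w \<noteq> {}\<close> show ?thesis by auto
qed

text \<open>All brackets are zero, so both differentials vanish: every element of the exterior square is a
cycle and only zero is a boundary. The multiplier is the exterior square itself, up to the trivial
quotient.\<close>

lemma dim_schur_multiplier_abelian:
  fixes A :: "('k, 'a, 'c) lie_alg_scheme"
  assumes vs: "vectorspace K A" and fd: "vectorspace.fin_dim K A" and ab: "lie_abelian A"
  shows "vectorspace.dim K (schur_multiplier K A) = vectorspace.dim K A choose 2"
proof -
  interpret A: vectorspace K A by (rule vs)
  let ?E = "ext_power K 2 A"
  interpret E: vectorspace K ?E by (rule A.ext_power_vectorspace)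
  have br: "bracket A x y = \<zero>\<^bsub>A\<^esub>" if "x \<in> carrier A" "y \<in> carrier A" for x y
    using ab that by (auto simp: lie_abelian_def)
  have t2: "xs ! 0 \<in> carrier A \<and> xs ! 1 \<in> carrier A" if "xs \<in> tuples 2 A" for xs
    using that by (auto simp: tuples_2_iff)
  have t3: "xs ! 0 \<in> carrier A \<and> xs ! 1 \<in> carrier A \<and> xs ! 2 \<in> carrier A" if "xs \<in> tuples 3 A" for xs
    using that by (auto simp: tuples_def numeral_3_eq_3 length_Suc_conv)
  have d2: "ce_d2 K A w = \<zero>\<^bsub>A\<^esub>" if "w \<in> carrier ?E" for w
    using A.lin_ext_image_coset[OF vs that, of "\<lambda>xs. bracket A (xs ! 0) (xs ! 1)"] br t2
    by (simp add: ce_d2_def)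
  let ?\<phi> = "\<lambda>xs. wedge K A [bracket A (xs ! 0) (xs ! 1), xs ! 2]
          \<ominus>\<^bsub>?E\<^esub> wedge K A [bracket A (xs ! 0) (xs ! 2), xs ! 1]
          \<oplus>\<^bsub>?E\<^esub> wedge K A [bracket A (xs ! 1) (xs ! 2), xs ! 0]"
  have "?\<phi> xs = \<zero>\<^bsub>?E\<^esub>" if "xs \<in> tuples 3 A" for xs
    using t3[OF that] by (simp add: br A.wedge2_zero a_minus_def)
  then have d3: "ce_d3 K A w = \<zero>\<^bsub>?E\<^esub>" if "w \<in> carrier (ext_power K 3 A)" for w
    using A.lin_ext_image_coset[OF E.vectorspace_axioms that, of ?\<phi>]
    by (simp add: ce_d3_def Let_def)
  interpret E3: vectorspace K "ext_power K 3 A" by (rule A.ext_power_vectorspace)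
  have "ce_d3 K A ` carrier (ext_power K 3 A) = {\<zero>\<^bsub>?E\<^esub>}"
    using d3 E3.M.zero_closed by blast
  moreover have "{w \<in> carrier ?E. ce_d2 K A w = \<zero>\<^bsub>A\<^esub>} = carrier ?E" using d2 by auto
  ultimately have "schur_multiplier K A = quot_space ?E {\<zero>\<^bsub>?E\<^esub>}"
    by (simp add: schur_multiplier_def Let_def)
  then show ?thesis
    using dim_quot_space_zero[OF E.vectorspace_axioms A.dim_ext_square(1)[OF fd]]
      A.dim_ext_square(2)[OF fd] by simp
qed

section \<open>The abelianization and the center\<close>

context lie_algebra
begin

lemma derived_subalgebra_subspace: "subspace K (derived_subalgebra K L) L"
  unfolding derived_subalgebra_def bracket_span_def
  by (rule span_is_subspace) (auto intro: bracket_closed)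

lemma bracket_in_derived_subalgebra:
  assumes "x \<in> carrier L" "y \<in> carrier L"
  shows "bracket L x y \<in> derived_subalgebra K L"
proof -
  let ?B = "{bracket L x y | x y. x \<in> carrier L \<and> y \<in> carrier L}"
  have "?B \<subseteq> carrier L" by (auto intro: bracket_closed)
  then have "?B \<subseteq> span ?B" by (rule in_own_span)
  then show ?thesis using assms by (auto simp: derived_subalgebra_def bracket_span_def)
qed

lemma lie_center_subspace: "subspace K (lie_center L) L"
proof -
  have "bracket L \<zero>\<^bsub>L\<^esub> x = \<zero>\<^bsub>L\<^esub>" if "x \<in> carrier L" for x
    using bracket_smult_left[of "\<zero>\<^bsub>K\<^esub>" "\<zero>\<^bsub>L\<^esub>" x] bracket_closed[of "\<zero>\<^bsub>L\<^esub>" x] that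
    by (simp add: lmult_0)
  then show ?thesis
    using vectorspace_axioms
    by (auto simp: subspace_def submodule_def lie_center_def module_axioms
        bracket_add_left bracket_smult_left)
qed

text \<open>The bracket of two cosets is the union of the cosets of the brackets of their members, and each of
these brackets lies in the derived subalgebra.\<close>

lemma lie_abelian_abelianization: "lie_abelian (quot_lie L (derived_subalgebra K L))"
proof -
  let ?D = "derived_subalgebra K L"
  let ?Q = "quot_lie L ?D"
  note sub = derived_subalgebra_subspace
  have "bracket ?Q X Y = \<zero>\<^bsub>?Q\<^esub>" if XY: "X \<in> carrier ?Q" "Y \<in> carrier ?Q" for X Y
  proof -
    have X: "X \<subseteq> carrier L \<and> X \<noteq> {}" if "X \<in> carrier ?Q" for X
    proof -
      obtain x where x: "x \<in> carrier L" "X = ?D +>\<^bsub>L\<^esub> x"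
        using \<open>X \<in> carrier ?Q\<close> by (auto simp: quotient_carrier[OF sub is_quotient_quot_lie])
      have "x \<in> X"
        using abelian_subgroup.a_rcos_self[OF subspace_abelian_subgroup[OF sub] x(1)] x(2) by simp
      moreover have "X \<subseteq> carrier L" using coset_subset[OF sub is_quotient_quot_lie x(1)] x(2) by simp
      ultimately show ?thesis by auto
    qed
    have "?D +>\<^bsub>L\<^esub> bracket L x y = ?D" if "x \<in> X" "y \<in> Y" for x y
    proof -
      have xy: "x \<in> carrier L" "y \<in> carrier L" using X[OF XY(1)] X[OF XY(2)] that by auto
      show ?thesis
        using coset_eq_zero_iff[OF sub is_quotient_quot_lie bracket_closed[OF xy]]
          bracket_in_derived_subalgebra[OF xy] by simp
    qed
    then have "(\<Union>x\<in>X. \<Union>y\<in>Y. ?D +>\<^bsub>L\<^esub> bracket L x y) = ?D"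
      using X[OF XY(1)] X[OF XY(2)] by auto
    then show ?thesis
      using quotient_zero[OF sub is_quotient_quot_lie] by (simp add: quot_lie_def)
  qed
  then show ?thesis by (simp add: lie_abelian_def)
qed

end

section \<open>Comparison of the two bounds\<close>

lemma real_choose_two: "real (q choose 2) = real q * (real q - 1) / 2"
proof (induction q)
  case (Suc q)
  have "Suc q choose 2 = q + (q choose 2)" by (simp add: numeral_2_eq_2)
  then show ?case using Suc by (simp add: algebra_simps)
qed simp

theorem theorem1p1:
  fixes K :: "('k, 'r) ring_scheme"
    and L :: "('k, 'a, 'c) lie_alg_scheme"
    and n m d :: nat
  assumes "lie_algebra K L"
    and "vectorspace.fin_dim K L"
    and "\<not> lie_abelian L"
    and "lie_nilpotent K L"
    and "vectorspace.dim K L = n"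
    and "vectorspace.dim K (L\<lparr>carrier := derived_subalgebra K L\<rparr>) = m"
    and "vectorspace.dim K (L\<lparr>carrier := lie_center L\<rparr>) = d"
    and "n \<ge> 3"
    and "d \<ge> 1"
    and "int m \<le> \<lfloor>(real n - 2) / (real d + 1)\<rfloor>"
  shows "1 / 2 * (real n + real m - 2) * (real n - real m - 1) + 1
    \<le> real (vectorspace.dim K (schur_multiplier K (quot_lie L (derived_subalgebra K L))))
      + real (vectorspace.dim K (L\<lparr>carrier := derived_subalgebra K L\<rparr>))
        * (real (vectorspace.dim K (quot_lie L (lie_center L))) - 1)"
proof -
  interpret L: lie_algebra K L by fact
  let ?A = "quot_lie L (derived_subalgebra K L)" and ?C = "quot_lie L (lie_center L)"
  note D = L.derived_subalgebra_subspace is_quotient_quot_lie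
  note Z = L.lie_center_subspace is_quotient_quot_lie
  define q where "q = vectorspace.dim K ?A"
  define z where "z = vectorspace.dim K ?C"
  have q: "q + m = n" using quotient_dim(2)[OF D assms(2)] assms(5,6) by (simp add: q_def)
  have z: "z + d = n" using quotient_dim(2)[OF Z assms(2)] assms(5,7) by (simp add: z_def)
  have "vectorspace.dim K (schur_multiplier K ?A) = q choose 2"
    unfolding q_def
    by (rule dim_schur_multiplier_abelian[OF quotient_vectorspace[OF D] quotient_dim(1)[OF D assms(2)]
          L.lie_abelian_abelianization])
  then have M: "real (vectorspace.dim K (schur_multiplier K ?A)) = real q * (real q - 1) / 2"
    by (simp add: real_choose_two)
  have "real m \<le> (real n - 2) / (real d + 1)"
    using assms(10) by (simp add: le_floor_iff)
  then have md: "real m * (real d + 1) \<le> real n - 2" by (simp add: pos_le_divide_eq)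
  have n: "real n = real q + real m" and zr: "real z = real n - real d"
    using q z by auto
  (* The difference of the two bounds is the slack in the hypothesis on m plus the square of m. *)
  have "real q * (real q - 1) / 2 + real m * (real z - 1)
      - (1 / 2 * (real n + real m - 2) * (real n - real m - 1) + 1)
      = (real n - 2 - real m * (real d + 1)) + real m * real m"
    unfolding zr n by (simp add: field_simps)
  also have "\<dots> \<ge> 0" using md by simp
  finally show ?thesis unfolding M assms(6) z_def[symmetric] by linarith
qed

end
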